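(* Let $M$ be an ultrametric space of cardinality at least $3$ (with a distinguished point $0\in M$). Then the Lipschitz-free space $\mathcal F(M)$ is not isometric to $\ell_1(\Gamma)$ for any set $\Gamma$.
   Context: A metric space $(M,d)$ is ultrametric if $d(x,y)\le\max\{d(x,z),d(y,z)\}$ for all $x,y,z\in M$. All Banach spaces are real. For a metric space $(M,d)$ with a distinguished point $0\in M$, $\mathrm{Lip}_0(M)$ is the Banach space of Lipschitz functions $f:M\to\mathbb R$ with $f(0)=0$, with norm $\|f\|_L=\sup\{\frac{f(x)-f(y)}{d(x,y)}:x\neq y\}$. The Lipschitz-free space $\mathcal F(M)$ is the norm-closed linear span of $\{\delta_x:x\in M\}$ in $\mathrm{Lip}_0(M)^*$, where $\delta_x(f)=f(x)$. *)

theory Defs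
  imports "HOL-Analysis.Analysis"
begin

text \<open>A pointed metric space is a type of sort \<open>{metric_space, zero}\<close>.  The class \<open>zero\<close>
  carries no axioms, so \<open>0\<close> is an arbitrary distinguished point.\<close>

typedef (overloaded) ('a :: "{metric_space, zero}") lip0 =
  "{f :: 'a \<Rightarrow> real. f 0 = 0 \<and> (\<exists>L. L-lipschitz_on UNIV f)}"
  morphisms lip0_apply Abs_lip0
  by (rule exI[of _ "\<lambda>_. 0"]) (auto intro: lipschitz_on_constant)

setup_lifting type_definition_lip0

lemma lip0_zero: "lip0_apply f 0 = 0"
  using lip0_apply[of f] by simp

lemma lip0_lipschitz: "\<exists>L. L-lipschitz_on UNIV (lip0_apply f)"
  using lip0_apply[of f] by simp

lemma lip0_bdd:
  fixes f :: "'a :: {metric_space, zero} lip0"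
  shows "bdd_above (range (\<lambda>(x, y). (lip0_apply f x - lip0_apply f y) / dist x y))"
proof -
  obtain L where L: "L-lipschitz_on UNIV (lip0_apply f)"
    using lip0_lipschitz by blast
  have "(lip0_apply f x - lip0_apply f y) / dist x y \<le> L" for x y
  proof (cases "x = y")
    case True
    then show ?thesis using lipschitz_on_nonneg[OF L] by simp
  next
    case False
    then show ?thesis
      using lipschitz_onD[OF L, of x y] by (simp add: divide_le_eq dist_real_def)
  qed
  then show ?thesis by (auto intro!: bdd_aboveI[of _ L])
qed

instantiation lip0 :: ("{metric_space, zero}") real_normed_vector
begin

lift_definition zero_lip0 :: "'a lip0" is "\<lambda>_. 0"
  by (auto intro: lipschitz_on_constant)

lift_definition plus_lip0 :: "'a lip0 \<Rightarrow> 'a lip0 \<Rightarrow> 'a lip0" is "\<lambda>f g x. f x + g x"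
  by (auto intro: lipschitz_on_add)

lift_definition minus_lip0 :: "'a lip0 \<Rightarrow> 'a lip0 \<Rightarrow> 'a lip0" is "\<lambda>f g x. f x - g x"
  by (auto intro: lipschitz_on_diff)

lift_definition uminus_lip0 :: "'a lip0 \<Rightarrow> 'a lip0" is "\<lambda>f x. - f x"
  by (auto intro: lipschitz_on_minus)

lift_definition scaleR_lip0 :: "real \<Rightarrow> 'a lip0 \<Rightarrow> 'a lip0" is "\<lambda>c f x. c * f x"
  by (auto intro: lipschitz_on_cmult_real)

text \<open>The diagonal pairs contribute \<open>0 / 0 = 0\<close> and hence do not affect the supremum, except that
  they make it \<open>0\<close> on the one-point space.  See \<open>norm_lip0_eq\<close> below.\<close>

definition norm_lip0 :: "'a lip0 \<Rightarrow> real"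
  where "norm_lip0 f = (SUP (x, y). (lip0_apply f x - lip0_apply f y) / dist x y)"

definition dist_lip0 :: "'a lip0 \<Rightarrow> 'a lip0 \<Rightarrow> real"
  where "dist_lip0 f g = norm (f - g)"

definition sgn_lip0 :: "'a lip0 \<Rightarrow> 'a lip0"
  where "sgn_lip0 f = inverse (norm f) *\<^sub>R f"

definition uniformity_lip0 :: "('a lip0 \<times> 'a lip0) filter"
  where "uniformity_lip0 = (INF e\<in>{0<..}. principal {(f, g). dist f g < e})"

definition open_lip0 :: "'a lip0 set \<Rightarrow> bool"
  where "open_lip0 U = (\<forall>f\<in>U. \<forall>\<^sub>F (f', g) in uniformity. f' = f \<longrightarrow> g \<in> U)"

instance
proof
  have le: "(lip0_apply f x - lip0_apply f y) / dist x y \<le> norm f" for f :: "'a lip0" and x y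
    using cSUP_upper[OF _ lip0_bdd[of f], of "(x, y)"] by (simp add: norm_lip0_def)
  have abs_le: "\<bar>lip0_apply f x - lip0_apply f y\<bar> \<le> norm f * dist x y" for f :: "'a lip0" and x y
  proof (cases "x = y")
    case False
    then show ?thesis using le[of f x y] le[of f y x]
      by (simp add: divide_le_eq abs_le_iff dist_commute)
  qed simp
  have nonneg: "0 \<le> norm f" for f :: "'a lip0"
    using le[of f 0 0] by simp
  have normI: "norm f \<le> C"
    if "0 \<le> C" "\<And>x y. \<bar>lip0_apply f x - lip0_apply f y\<bar> \<le> C * dist x y" for f :: "'a lip0" and C
    unfolding norm_lip0_def
  proof (rule cSUP_least, simp, clarify)
    fix x y
    show "(lip0_apply f x - lip0_apply f y) / dist x y \<le> C"
      using that(1) that(2)[of x y] by (cases "x = y") (simp_all add: divide_le_eq abs_le_iff)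
  qed
  fix f g h :: "'a lip0" and a b :: real
  show "f + g + h = f + (g + h)" by transfer (simp add: add.assoc)
  show "f + g = g + f" by transfer (simp add: add.commute)
  show "0 + f = f" by transfer simp
  show "- f + f = 0" by transfer simp
  show "f - g = f + - g" by transfer simp
  show "a *\<^sub>R (f + g) = a *\<^sub>R f + a *\<^sub>R g" by transfer (simp add: distrib_left)
  show "(a + b) *\<^sub>R f = a *\<^sub>R f + b *\<^sub>R f" by transfer (simp add: distrib_right)
  show "a *\<^sub>R b *\<^sub>R f = (a * b) *\<^sub>R f" by transfer (simp add: mult.assoc)
  show "1 *\<^sub>R f = f" by transfer simp
  show "dist f g = norm (f - g)" by (rule dist_lip0_def)
  show "sgn f = inverse (norm f) *\<^sub>R f" by (rule sgn_lip0_def)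
  show "(uniformity :: ('a lip0 \<times> 'a lip0) filter) = (INF e\<in>{0<..}. principal {(f, g). dist f g < e})"
    by (rule uniformity_lip0_def)
  show "open U = (\<forall>f\<in>U. \<forall>\<^sub>F (f', g) in uniformity. f' = f \<longrightarrow> g \<in> U)" for U :: "'a lip0 set"
    by (rule open_lip0_def)
  show "(norm f = 0) = (f = 0)"
  proof
    assume "norm f = 0"
    then have "lip0_apply f x = 0" for x
      using abs_le[of f x 0] by (simp add: lip0_zero)
    then show "f = 0" by transfer auto
  next
    assume "f = 0"
    then have "norm f \<le> 0" by (intro normI) (simp_all add: zero_lip0.rep_eq)
    then show "norm f = 0" using nonneg[of f] by simp
  qed
  show "norm (f + g) \<le> norm f + norm g"
  proof (rule normI)
    fix x y
    show "\<bar>lip0_apply (f + g) x - lip0_apply (f + g) y\<bar> \<le> (norm f + norm g) * dist x y"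
      using abs_le[of f x y] abs_le[of g x y]
      unfolding plus_lip0.rep_eq distrib_right by linarith
  qed (simp add: nonneg)
  have scale_le: "norm (c *\<^sub>R k) \<le> \<bar>c\<bar> * norm k" for c and k :: "'a lip0"
  proof (rule normI)
    fix x y
    have "\<bar>lip0_apply (c *\<^sub>R k) x - lip0_apply (c *\<^sub>R k) y\<bar>
        = \<bar>c\<bar> * \<bar>lip0_apply k x - lip0_apply k y\<bar>"
      by (simp add: scaleR_lip0.rep_eq abs_mult flip: right_diff_distrib)
    also have "\<dots> \<le> \<bar>c\<bar> * (norm k * dist x y)"
      by (intro mult_left_mono abs_le) simp
    finally show "\<bar>lip0_apply (c *\<^sub>R k) x - lip0_apply (c *\<^sub>R k) y\<bar> \<le> \<bar>c\<bar> * norm k * dist x y"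
      by (simp add: mult.assoc)
  qed (simp add: nonneg)
  show "norm (a *\<^sub>R f) = \<bar>a\<bar> * norm f"
  proof (cases "a = 0")
    case True
    then show ?thesis using scale_le[of a f] nonneg[of "a *\<^sub>R f"] by simp
  next
    case False
    have "inverse a *\<^sub>R a *\<^sub>R f = f"
      using False by (transfer) (simp add: fun_eq_iff)
    then have "norm f \<le> \<bar>inverse a\<bar> * norm (a *\<^sub>R f)"
      using scale_le[of "inverse a" "a *\<^sub>R f"] by simp
    then have "\<bar>a\<bar> * norm f \<le> norm (a *\<^sub>R f)"
      using False by (simp add: field_simps)
    then show ?thesis using scale_le[of a f] by simp
  qed
qed

end

lemma norm_lip0_eq:
  fixes f :: "'a :: {metric_space, zero} lip0"
  assumes "\<exists>x y :: 'a. x \<noteq> y"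
  shows "norm f = Sup {(lip0_apply f x - lip0_apply f y) / dist x y | x y. x \<noteq> y}"
proof -
  define q where "q x y = (lip0_apply f x - lip0_apply f y) / dist x y" for x y
  let ?S = "{q x y | x y. x \<noteq> y}"
  have bdd: "bdd_above (range (\<lambda>(x, y). q x y))"
    using lip0_bdd[of f] unfolding q_def .
  have sub: "?S \<subseteq> range (\<lambda>(x, y). q x y)"
    by auto
  have bddS: "bdd_above ?S"
    by (rule bdd_above_mono[OF bdd sub])
  obtain u v :: 'a where uv: "u \<noteq> v" using assms by blast
  have ge: "q x y \<le> Sup ?S" if "x \<noteq> y" for x y
    using that by (intro cSup_upper bddS) auto
  have "q u v = - q v u"
    by (simp add: q_def dist_commute minus_divide_left)
  then have nonneg: "0 \<le> Sup ?S"
    using ge[OF uv] ge[OF uv[symmetric]] by linarith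
  have "(SUP (x, y). q x y) \<le> Sup ?S"
  proof (rule cSUP_least, simp, clarify)
    fix x y
    show "q x y \<le> Sup ?S"
      using ge[of x y] nonneg by (cases "x = y") (simp_all add: q_def)
  qed
  moreover have "Sup ?S \<le> (SUP (x, y). q x y)"
    using uv by (intro cSup_subset_mono bdd sub) auto
  ultimately show ?thesis
    by (simp add: norm_lip0_def q_def)
qed

lemma lip0_eval_bound:
  fixes f :: "'a :: {metric_space, zero} lip0"
  shows "\<bar>lip0_apply f x - lip0_apply f y\<bar> \<le> norm f * dist x y"
proof (cases "x = y")
  case False
  have "(lip0_apply f u - lip0_apply f v) / dist u v \<le> norm f" for u v
    using cSUP_upper[OF _ lip0_bdd[of f], of "(u, v)"] by (simp add: norm_lip0_def)
  from this[of x y] this[of y x] False show ?thesis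
    by (simp add: divide_le_eq abs_le_iff dist_commute)
qed simp

lift_definition lip_delta :: "'a :: {metric_space, zero} \<Rightarrow> ('a lip0 \<Rightarrow>\<^sub>L real)"
  is "\<lambda>x f. lip0_apply f x"
proof -
  fix x :: 'a
  show "bounded_linear (\<lambda>f. lip0_apply f x)"
  proof (rule bounded_linear_intro)
    fix f :: "'a lip0"
    show "norm (lip0_apply f x) \<le> norm f * dist x 0"
      using lip0_eval_bound[of f x 0] by (simp add: lip0_zero)
  qed (simp_all add: plus_lip0.rep_eq scaleR_lip0.rep_eq)
qed

definition lipschitz_free :: "'a itself \<Rightarrow> ('a :: {metric_space, zero} lip0 \<Rightarrow>\<^sub>L real) set"
  where "lipschitz_free _ = closure (span (range lip_delta))"

lemma summable_abs_add:
  fixes f g :: "'g \<Rightarrow> real"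
  assumes "(\<lambda>i. \<bar>f i\<bar>) summable_on UNIV" "(\<lambda>i. \<bar>g i\<bar>) summable_on UNIV"
  shows "(\<lambda>i. \<bar>f i + g i\<bar>) summable_on UNIV"
  by (rule summable_on_comparison_test[OF summable_on_add[OF assms]])
    (simp_all add: abs_triangle_ineq)

typedef 'g ell1 = "{f :: 'g \<Rightarrow> real. (\<lambda>i. \<bar>f i\<bar>) summable_on UNIV}"
  morphisms ell1_apply Abs_ell1
  by (rule exI[of _ "\<lambda>_. 0"]) simp

setup_lifting type_definition_ell1

instantiation ell1 :: (type) real_normed_vector
begin

lift_definition zero_ell1 :: "'a ell1" is "\<lambda>_. 0"
  by simp

lift_definition plus_ell1 :: "'a ell1 \<Rightarrow> 'a ell1 \<Rightarrow> 'a ell1" is "\<lambda>f g i. f i + g i"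
  using summable_abs_add by blast

lift_definition uminus_ell1 :: "'a ell1 \<Rightarrow> 'a ell1" is "\<lambda>f i. - f i"
  by simp

lift_definition minus_ell1 :: "'a ell1 \<Rightarrow> 'a ell1 \<Rightarrow> 'a ell1" is "\<lambda>f g i. f i - g i"
proof -
  fix f g :: "'a \<Rightarrow> real"
  assume "(\<lambda>i. \<bar>f i\<bar>) summable_on UNIV" "(\<lambda>i. \<bar>g i\<bar>) summable_on UNIV"
  then show "(\<lambda>i. \<bar>f i - g i\<bar>) summable_on UNIV"
    using summable_abs_add[of f "\<lambda>i. - g i"] by simp
qed

lift_definition scaleR_ell1 :: "real \<Rightarrow> 'a ell1 \<Rightarrow> 'a ell1" is "\<lambda>c f i. c * f i"
  by (auto simp: abs_mult intro: summable_on_cmult_right)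

lift_definition norm_ell1 :: "'a ell1 \<Rightarrow> real" is "\<lambda>f. \<Sum>\<^sub>\<infinity>i. \<bar>f i\<bar>" .

definition dist_ell1 :: "'a ell1 \<Rightarrow> 'a ell1 \<Rightarrow> real"
  where "dist_ell1 f g = norm (f - g)"

definition sgn_ell1 :: "'a ell1 \<Rightarrow> 'a ell1"
  where "sgn_ell1 f = inverse (norm f) *\<^sub>R f"

definition uniformity_ell1 :: "('a ell1 \<times> 'a ell1) filter"
  where "uniformity_ell1 = (INF e\<in>{0<..}. principal {(f, g). dist f g < e})"

definition open_ell1 :: "'a ell1 set \<Rightarrow> bool"
  where "open_ell1 U = (\<forall>f\<in>U. \<forall>\<^sub>F (f', g) in uniformity. f' = f \<longrightarrow> g \<in> U)"

instance
proof
  fix f g h :: "'a ell1" and a b :: real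
  show "f + g + h = f + (g + h)" by transfer (simp add: add.assoc)
  show "f + g = g + f" by transfer (simp add: add.commute)
  show "0 + f = f" by transfer simp
  show "- f + f = 0" by transfer simp
  show "f - g = f + - g" by transfer simp
  show "a *\<^sub>R (f + g) = a *\<^sub>R f + a *\<^sub>R g" by transfer (simp add: distrib_left)
  show "(a + b) *\<^sub>R f = a *\<^sub>R f + b *\<^sub>R f" by transfer (simp add: distrib_right)
  show "a *\<^sub>R b *\<^sub>R f = (a * b) *\<^sub>R f" by transfer (simp add: mult.assoc)
  show "1 *\<^sub>R f = f" by transfer simp
  show "dist f g = norm (f - g)" by (rule dist_ell1_def)
  show "sgn f = inverse (norm f) *\<^sub>R f" by (rule sgn_ell1_def)
  show "(uniformity :: ('a ell1 \<times> 'a ell1) filter) = (INF e\<in>{0<..}. principal {(f, g). dist f g < e})"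
    by (rule uniformity_ell1_def)
  show "open U = (\<forall>f\<in>U. \<forall>\<^sub>F (f', g) in uniformity. f' = f \<longrightarrow> g \<in> U)" for U :: "'a ell1 set"
    by (rule open_ell1_def)
  show "(norm f = 0) = (f = 0)"
  proof transfer
    fix f :: "'a \<Rightarrow> real"
    assume f: "(\<lambda>i. \<bar>f i\<bar>) summable_on UNIV"
    show "((\<Sum>\<^sub>\<infinity>i. \<bar>f i\<bar>) = 0) = (f = (\<lambda>_. 0))"
    proof
      assume "(\<Sum>\<^sub>\<infinity>i. \<bar>f i\<bar>) = 0"
      then have "\<bar>f i\<bar> = 0" for i
        using nonneg_infsum_le_0D[of "\<lambda>i. \<bar>f i\<bar>" UNIV i] f by simp
      then show "f = (\<lambda>_. 0)" by auto
    qed simp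
  qed
  show "norm (f + g) \<le> norm f + norm g"
  proof transfer
    fix f g :: "'a \<Rightarrow> real"
    assume f: "(\<lambda>i. \<bar>f i\<bar>) summable_on UNIV"
      and g: "(\<lambda>i. \<bar>g i\<bar>) summable_on UNIV"
    have "(\<lambda>i. \<bar>f i + g i\<bar>) summable_on UNIV"
      using f g using summable_abs_add by blast
    then have "(\<Sum>\<^sub>\<infinity>i. \<bar>f i + g i\<bar>) \<le> (\<Sum>\<^sub>\<infinity>i. \<bar>f i\<bar> + \<bar>g i\<bar>)"
      using f g by (intro infsum_mono summable_on_add) auto
    also have "\<dots> = (\<Sum>\<^sub>\<infinity>i. \<bar>f i\<bar>) + (\<Sum>\<^sub>\<infinity>i. \<bar>g i\<bar>)"
      using f g by (intro infsum_add) auto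
    finally show "(\<Sum>\<^sub>\<infinity>i. \<bar>f i + g i\<bar>) \<le> (\<Sum>\<^sub>\<infinity>i. \<bar>f i\<bar>) + (\<Sum>\<^sub>\<infinity>i. \<bar>g i\<bar>)" .
  qed
  show "norm (a *\<^sub>R f) = \<bar>a\<bar> * norm f"
    by transfer (simp add: abs_mult infsum_cmult_right')
qed

end

text \<open>\<open>\<ell>\<^sub>1(\<Gamma>)\<close> for an arbitrary, possibly empty, set \<open>\<Gamma>\<close>, its elements being extended by \<open>0\<close>
  outside \<open>\<Gamma>\<close>.\<close>

definition ell1_space :: "'g set \<Rightarrow> 'g ell1 set"
  where "ell1_space \<Gamma> = {x. \<forall>i. i \<notin> \<Gamma> \<longrightarrow> ell1_apply x i = 0}"

text \<open>Intended for linear subspaces \<open>X\<close> and \<open>Y\<close>: a linear norm-preserving bijection between them.\<close>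

definition isometric_spaces ::
    "'a :: real_normed_vector set \<Rightarrow> 'b :: real_normed_vector set \<Rightarrow> bool"
  where "isometric_spaces X Y \<longleftrightarrow>
    (\<exists>T. bij_betw T X Y \<and>
         (\<forall>x\<in>X. \<forall>y\<in>X. T (x + y) = T x + T y) \<and>
         (\<forall>c. \<forall>x\<in>X. T (c *\<^sub>R x) = c *\<^sub>R T x) \<and>
         (\<forall>x\<in>X. norm (T x) = norm x))"

end

theory Submission
  imports Defs
begin

text \<open>Choose three points with \<open>s = dist x y \<le> r = dist x z = dist y z\<close>. In \<open>\<ell>\<^sub>1(\<Gamma>)\<close> any three points
  have a median lying on the metric segments between them, so an isometry would produce \<open>\<mu>\<close> in the
  free space with \<open>norm \<mu> = r - s/2\<close> at distance \<open>s/2\<close> from both \<open>\<delta>\<^sub>x - \<delta>\<^sub>z\<close> and \<open>\<delta>\<^sub>y - \<delta>\<^sub>z\<close>. Then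
  \<open>\<mu> F = r - s/2\<close> for every 1-Lipschitz \<open>F\<close> that attains \<open>F x - F z = r\<close> or \<open>F y - F z = r\<close>. Let \<open>N\<close> be
  the complement of the open \<open>r\<close>-ball at \<open>z\<close> and \<open>P \<subseteq> N\<close> the open \<open>s\<close>-ball at \<open>x\<close>. By the ultrametric
  inequality \<open>r 1\<^sub>N\<close>, \<open>r 1\<^sub>N - s 1\<^sub>P\<close> and \<open>r 1\<^sub>N - s 1\<^bsub>N - P\<^esub>\<close> are such functions, but the last two
  add up to \<open>2 - s/r\<close> times the first, which is impossible.\<close>

lemma norm_lip0_le:
  fixes f :: "'a :: {metric_space, zero} lip0"
  assumes "L-lipschitz_on UNIV (lip0_apply f)"
  shows "norm f \<le> L"
  unfolding norm_lip0_def
proof (rule cSUP_least, simp, clarify)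
  fix x y
  show "(lip0_apply f x - lip0_apply f y) / dist x y \<le> L"
    using lipschitz_on_nonneg[OF assms] lipschitz_onD[OF assms, of x y]
    by (cases "x = y") (simp_all add: divide_le_eq dist_real_def)
qed

text \<open>Subtracting a constant changes no difference of values, so test functions can be built
  wherever the base point lies.\<close>

lemma lipschitz_on_normalize:
  fixes f :: "'a :: {metric_space, zero} \<Rightarrow> real"
  assumes "L-lipschitz_on UNIV f"
  obtains F where "norm F \<le> L" "\<And>p. lip0_apply F p = f p - f 0"
proof -
  have lip: "L-lipschitz_on UNIV (\<lambda>p. f p - f 0)"
    using assms by (simp add: lipschitz_on_def dist_real_def)
  then have "lip0_apply (Abs_lip0 (\<lambda>p. f p - f 0)) = (\<lambda>p. f p - f 0)"
    by (intro Abs_lip0_inverse) auto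
  with norm_lip0_le[of L "Abs_lip0 (\<lambda>p. f p - f 0)"] lip show ?thesis
    by (intro that[of "Abs_lip0 (\<lambda>p. f p - f 0)"]) simp_all
qed

lemma lip_delta_apply [simp]: "blinfun_apply (lip_delta x) f = lip0_apply f x"
  by transfer simp

lemma norm_lip_delta_diff:
  fixes x y :: "'a :: {metric_space, zero}"
  shows "norm (lip_delta x - lip_delta y) = dist x y"
proof (rule antisym)
  show "norm (lip_delta x - lip_delta y) \<le> dist x y"
    by (rule norm_blinfun_bound)
      (use lip0_eval_bound[of _ x y] in \<open>auto simp: blinfun.diff_left mult.commute\<close>)
  \<comment> \<open>The distance to \<open>y\<close>, shifted to vanish at \<open>0\<close>, attains
    the lower bound.\<close>
  have "1-lipschitz_on UNIV (\<lambda>p. dist p y)"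
    using abs_dist_diff_le[of _ y] by (intro lipschitz_onI) (auto simp: dist_real_def dist_commute[of y])
  then obtain F where F: "norm F \<le> 1" "\<And>p. lip0_apply F p = dist p y - dist 0 y"
    by (rule lipschitz_on_normalize) blast
  have "dist x y = blinfun_apply (lip_delta x - lip_delta y) F"
    by (simp add: blinfun.diff_left F)
  also have "\<dots> \<le> norm (lip_delta x - lip_delta y) * norm F"
    using norm_blinfun[of "lip_delta x - lip_delta y" F] by simp
  also have "\<dots> \<le> norm (lip_delta x - lip_delta y)"
    using F(1) by (simp add: mult_left_le)
  finally show "dist x y \<le> norm (lip_delta x - lip_delta y)" .
qed

lemma subspace_closure:
  fixes S :: "'a :: real_normed_vector set"
  assumes "subspace S"
  shows "subspace (closure S)"
proof (rule subspaceI)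
  show "0 \<in> closure S"
    using subspace_0[OF assms] closure_subset by blast
next
  fix x y assume "x \<in> closure S" "y \<in> closure S"
  then obtain f g where f: "\<And>n. f n \<in> S" "f \<longlonglongrightarrow> x" and g: "\<And>n. g n \<in> S" "g \<longlonglongrightarrow> y"
    unfolding closure_sequential by blast
  have "f n + g n \<in> S" for n
    using subspace_add[OF assms f(1) g(1)] .
  with tendsto_add[OF f(2) g(2)] show "x + y \<in> closure S"
    unfolding closure_sequential by (intro exI[of _ "\<lambda>n. f n + g n"]) simp
next
  fix c :: real and x assume "x \<in> closure S"
  then obtain f where f: "\<And>n. f n \<in> S" "f \<longlonglongrightarrow> x"
    unfolding closure_sequential by blast
  have "c *\<^sub>R f n \<in> S" for n
    using subspace_scale[OF assms f(1)] .
  with tendsto_scaleR[OF tendsto_const f(2)] show "c *\<^sub>R x \<in> closure S"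
    unfolding closure_sequential by (intro exI[of _ "\<lambda>n. c *\<^sub>R f n"]) simp
qed

lemma subspace_lipschitz_free: "subspace (lipschitz_free TYPE('a :: {metric_space, zero}))"
  unfolding lipschitz_free_def by (rule subspace_closure[OF subspace_span])

lemma lip_delta_in_lipschitz_free: "lip_delta x \<in> lipschitz_free TYPE('a :: {metric_space, zero})"
  unfolding lipschitz_free_def by (rule subsetD[OF closure_subset span_base[OF rangeI]])

text \<open>The coordinatewise median of \<open>0\<close>, \<open>a\<close> and \<open>b\<close>
  works: the norm sums absolute values, and each identity already holds in every coordinate.\<close>

lemma ell1_median:
  fixes a b :: "'g ell1"
  assumes "a \<in> ell1_space \<Gamma>" "b \<in> ell1_space \<Gamma>"
  obtains m where "m \<in> ell1_space \<Gamma>"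
    "norm m + norm (a - m) = norm a"
    "norm m + norm (b - m) = norm b"
    "norm (a - m) + norm (b - m) = norm (a - b)"
proof -
  let ?a = "ell1_apply a" and ?b = "ell1_apply b"
  \<comment> \<open>Equal signs give the value closer to \<open>0\<close>, opposite signs give
    \<open>0\<close>.\<close>
  define m where "m i = max (min (?a i) (?b i)) 0 + min (max (?a i) (?b i)) 0" for i
  have sum: "(\<lambda>i. \<bar>ell1_apply c i\<bar>) summable_on UNIV" for c :: "'g ell1"
    using ell1_apply[of c] by simp
  have "(\<lambda>i. \<bar>m i\<bar>) summable_on UNIV"
    by (rule summable_on_comparison_test[OF sum[of a]]) (auto simp: m_def)
  then have m: "ell1_apply (Abs_ell1 m) = m"
    by (simp add: Abs_ell1_inverse)
  have norm_add: "norm c + norm d = norm e"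
    if "\<And>i. \<bar>ell1_apply c i\<bar> + \<bar>ell1_apply d i\<bar> = \<bar>ell1_apply e i\<bar>" for c d e :: "'g ell1"
    unfolding norm_ell1.rep_eq by (subst infsum_add[symmetric]) (simp_all add: sum that)
  show ?thesis
  proof (rule that[of "Abs_ell1 m"])
    show "Abs_ell1 m \<in> ell1_space \<Gamma>"
      using assms by (auto simp: ell1_space_def m m_def)
    show "norm (Abs_ell1 m) + norm (a - Abs_ell1 m) = norm a"
      by (rule norm_add) (auto simp: minus_ell1.rep_eq m m_def max_def min_def)
    show "norm (Abs_ell1 m) + norm (b - Abs_ell1 m) = norm b"
      by (rule norm_add) (auto simp: minus_ell1.rep_eq m m_def max_def min_def)
    show "norm (a - Abs_ell1 m) + norm (b - Abs_ell1 m) = norm (a - b)"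
      by (rule norm_add) (auto simp: minus_ell1.rep_eq m m_def max_def min_def)
  qed
qed

text \<open>Surjectivity onto \<open>ell1_space \<Gamma>\<close> pulls the median of
  \<open>0\<close>, \<open>T A\<close> and \<open>T B\<close> back to \<open>X\<close>.\<close>

lemma isometric_ell1_median:
  assumes "isometric_spaces X (ell1_space \<Gamma>)" and X: "subspace X" and A: "A \<in> X" and B: "B \<in> X"
  obtains \<mu> where
    "norm \<mu> + norm (A - \<mu>) = norm A"
    "norm \<mu> + norm (B - \<mu>) = norm B"
    "norm (A - \<mu>) + norm (B - \<mu>) = norm (A - B)"
proof -
  obtain T where bij: "bij_betw T X (ell1_space \<Gamma>)"
    and add: "\<And>x y. x \<in> X \<Longrightarrow> y \<in> X \<Longrightarrow> T (x + y) = T x + T y"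
    and norm: "\<And>x. x \<in> X \<Longrightarrow> norm (T x) = norm x"
    using assms(1) unfolding isometric_spaces_def by blast
  have diff: "norm (T x - T y) = norm (x - y)" if "x \<in> X" "y \<in> X" for x y
  proof -
    have "x - y \<in> X"
      using subspace_diff[OF X that] .
    \<comment> \<open>Additivity is applied to \<open>(x - y) + y\<close>.\<close>
    from add[OF this that(2)] norm[OF this] show ?thesis
      by (simp add: algebra_simps)
  qed
  have "T A \<in> ell1_space \<Gamma>" "T B \<in> ell1_space \<Gamma>"
    using bij A B by (auto simp: bij_betw_def)
  then obtain m where "m \<in> ell1_space \<Gamma>"
    and m: "norm m + norm (T A - m) = norm (T A)" "norm m + norm (T B - m) = norm (T B)"
      "norm (T A - m) + norm (T B - m) = norm (T A - T B)"
    by (rule ell1_median)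
  obtain \<mu> where \<mu>: "\<mu> \<in> X" "m = T \<mu>"
    using \<open>m \<in> ell1_space \<Gamma>\<close> bij_betw_imp_surj_on[OF bij] by blast
  show ?thesis
    using m unfolding \<mu>(2) norm[OF \<mu>(1)] norm[OF A] norm[OF B] diff[OF A \<mu>(1)]
      diff[OF B \<mu>(1)] diff[OF A B] by (rule that)
qed

text \<open>Take \<open>u\<close>, \<open>v\<close> as the ends of a shortest side; the ultrametric
  inequality bounds each of the other two sides by the other.\<close>

lemma ultrametric_isosceles_triple:
  fixes x y z :: "'a :: metric_space"
  assumes ultra: "\<And>x y z :: 'a. dist x y \<le> max (dist x z) (dist y z)"
    and "x \<noteq> y" "x \<noteq> z" "y \<noteq> z"
  obtains u v w :: 'a where "u \<noteq> v" "dist u v \<le> dist u w" "dist v w = dist u w"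
proof -
  have isosceles: "dist u w = dist v w" if "dist u v \<le> dist u w" "dist u v \<le> dist v w" for u v w :: 'a
    using that ultra[of u w v] ultra[of v w u] by (simp add: dist_commute max_def split: if_splits)
  consider "dist x y \<le> dist x z" "dist x y \<le> dist y z" | "dist x z \<le> dist x y" "dist x z \<le> dist z y"
    | "dist y z \<le> dist y x" "dist y z \<le> dist z x"
    using dist_commute[of y x] dist_commute[of z x] dist_commute[of z y] by linarith
  then show ?thesis
  proof cases
    case 1
    then show ?thesis using that[of x y z] isosceles[of x y z] assms(2) by simp
  next
    case 2
    then show ?thesis using that[of x z y] isosceles[of x z y] assms(3) by simp
  next
    case 3
    then show ?thesis using that[of y z x] isosceles[of y z x] assms(4) by simp
  qed
qed

theorem corollary6:
  fixes \<Gamma> :: "'g set"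
  assumes "\<forall>x y z :: 'a :: {metric_space, zero}. dist x y \<le> max (dist x z) (dist y z)"
    and "infinite (UNIV :: 'a set) \<or> card (UNIV :: 'a set) \<ge> 3"
  shows "\<not> isometric_spaces (lipschitz_free TYPE('a)) (ell1_space \<Gamma>)"
proof
  assume iso: "isometric_spaces (lipschitz_free TYPE('a)) (ell1_space \<Gamma>)"
  have ultra: "dist p q \<le> max (dist p o') (dist q o')" for p q o' :: 'a
    using assms(1) by blast
  obtain S :: "'a set" where "card S = 3"
    using assms(2) infinite_arbitrarily_large[of "UNIV :: 'a set" 3] obtain_subset_with_card_n by metis
  then obtain x0 y0 z0 :: 'a where "x0 \<noteq> y0" "x0 \<noteq> z0" "y0 \<noteq> z0"
    by (auto simp: card_3_iff)
  then obtain x y z :: 'a where "x \<noteq> y" and le: "dist x y \<le> dist x z" and eq: "dist y z = dist x z"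
    using ultrametric_isosceles_triple[OF ultra] by metis
  define r s where "r = dist x z" and "s = dist x y"
  have s: "0 < s" and sr: "s \<le> r"
    using \<open>x \<noteq> y\<close> le by (simp_all add: r_def s_def)
  let ?A = "lip_delta x - lip_delta z" and ?B = "lip_delta y - lip_delta z"
  have "?A \<in> lipschitz_free TYPE('a)" "?B \<in> lipschitz_free TYPE('a)"
    by (intro subspace_diff subspace_lipschitz_free lip_delta_in_lipschitz_free)+
  from isometric_ell1_median[OF iso subspace_lipschitz_free this] obtain \<mu> where
    "norm \<mu> + norm (?A - \<mu>) = r" "norm \<mu> + norm (?B - \<mu>) = r" "norm (?A - \<mu>) + norm (?B - \<mu>) = s"
    by (auto simp: norm_lip_delta_diff eq r_def s_def)
  \<comment> \<open>Adding the first two equations and inserting the third gives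
    \<open>2 * norm \<mu> + s = 2 * r\<close>.\<close>
  then have \<mu>: "norm \<mu> = r - s/2" "norm (?A - \<mu>) = s/2" "norm (?B - \<mu>) = s/2"
    by auto
  have le_norm: "blinfun_apply \<phi> F \<le> norm \<phi>" if "norm F \<le> 1" for \<phi> and F :: "'a lip0"
    using norm_blinfun[of \<phi> F] mult_left_le[OF that norm_ge_zero[of \<phi>]] by simp
  \<comment> \<open>If \<open>?A\<close> takes the value \<open>r\<close> at \<open>F\<close>, then
    \<open>\<mu>\<close> and \<open>?A - \<mu>\<close> contribute at most \<open>r - s/2\<close> and
    \<open>s/2\<close>, so both bounds are attained; likewise for \<open>?B\<close>.\<close>
  have val: "blinfun_apply \<mu> F = r - s/2"
    if "norm F \<le> 1" "lip0_apply F x - lip0_apply F z = r \<or> lip0_apply F y - lip0_apply F z = r" for F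
    using le_norm[OF that(1), of \<mu>] le_norm[OF that(1), of "?A - \<mu>"] le_norm[OF that(1), of "?B - \<mu>"]
      that(2) by (auto simp: \<mu> blinfun.diff_left)
  define N P where "N = {p. r \<le> dist p z}" and "P = {p. dist p x < s}"
  have PN: "P \<subseteq> N"
  proof
    fix p assume "p \<in> P"
    then show "p \<in> N"
      using ultra[of x z p] sr by (auto simp: N_def P_def r_def dist_commute max_def split: if_splits)
  qed
  \<comment> \<open>An open ball in an ultrametric space lies at distance at least its radius from
    every outside point.\<close>
  have distN: "r \<le> dist p q" if "p \<in> N" "q \<notin> N" for p q
    using that ultra[of p z q] by (auto simp: N_def dist_commute max_def split: if_splits)
  have distP: "s \<le> dist p q" if "p \<notin> P" "q \<in> P" for p q
    using that ultra[of p x q] by (auto simp: P_def dist_commute max_def split: if_splits)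
  define f :: "real \<Rightarrow> real \<Rightarrow> 'a \<Rightarrow> real"
    where "f b c p = (if p \<in> P then b else if p \<in> N then c else 0)" for b c p
  \<comment> \<open>Leaving \<open>N\<close> changes \<open>f b c\<close> by at most
    \<open>r\<close> over a distance of at least \<open>r\<close>; passing between \<open>P\<close>
    and \<open>N - P\<close> changes it by at most \<open>s\<close> over at least
    \<open>s\<close>.\<close>
  have lip_ex: "\<exists>F. norm F \<le> 1 \<and> (\<forall>p. lip0_apply F p = f b c p - f b c 0)"
    if "0 \<le> b" "b \<le> r" "0 \<le> c" "c \<le> r" "\<bar>b - c\<bar> \<le> s" for b c
  proof -
    have "1-lipschitz_on UNIV (f b c)"
    proof (rule lipschitz_onI)
      fix p q
      show "dist (f b c p) (f b c q) \<le> 1 * dist p q"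
        using that subsetD[OF PN, of p] subsetD[OF PN, of q] zero_le_dist[of p q]
          distN[of p q] distN[of q p, unfolded dist_commute[of q p]]
          distP[of p q] distP[of q p, unfolded dist_commute[of q p]]
        by (cases "p \<in> P"; cases "q \<in> P"; cases "p \<in> N"; cases "q \<in> N")
          (simp_all add: f_def dist_real_def)
    qed simp
    then show ?thesis by (metis lipschitz_on_normalize)
  qed
  have ex: "\<exists>F. norm F \<le> 1 \<and> (\<forall>p. lip0_apply F p = f b c p - f b c 0)"
    if "b \<in> {r - s, r}" "c \<in> {r - s, r}" for b c
    by (rule lip_ex) (use that s sr in auto)
  obtain F1 where F1: "norm F1 \<le> 1" "\<And>p. lip0_apply F1 p = f r r p - f r r 0"
    using ex[of r r] by blast
  obtain F2 where F2: "norm F2 \<le> 1" "\<And>p. lip0_apply F2 p = f (r - s) r p - f (r - s) r 0"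
    using ex[of "r - s" r] by blast
  obtain F3 where F3: "norm F3 \<le> 1" "\<And>p. lip0_apply F3 p = f r (r - s) p - f r (r - s) 0"
    using ex[of r "r - s"] by blast
  note F = F1(1) F2(1) F3(1) and ap = F1(2) F2(2) F3(2)
  have mem: "x \<in> P" "y \<notin> P" "y \<in> N" "z \<notin> N" "z \<notin> P"
    using s sr eq PN by (auto simp: P_def N_def r_def s_def dist_commute)
  \<comment> \<open>Before normalisation at \<open>0\<close>, both sides are
    \<open>2 * r - s\<close> on \<open>N\<close> and \<open>0\<close> elsewhere.\<close>
  have "F2 + F3 = (2 - s/r) *\<^sub>R F1"
  proof (rule lip0_apply_inject[THEN iffD1], rule ext)
    fix p
    show "lip0_apply (F2 + F3) p = lip0_apply ((2 - s/r) *\<^sub>R F1) p"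
      using s sr by (simp add: plus_lip0.rep_eq scaleR_lip0.rep_eq ap f_def field_simps)
  qed
  then have "blinfun_apply \<mu> F2 + blinfun_apply \<mu> F3 = (2 - s/r) * blinfun_apply \<mu> F1"
    by (metis blinfun.add_right blinfun.scaleR_right real_scaleR_def)
  \<comment> \<open>\<open>F1\<close> and \<open>F3\<close> rise by \<open>r\<close> from
    \<open>z\<close> to \<open>x\<close>, and \<open>F2\<close> from \<open>z\<close> to
    \<open>y\<close>.\<close>
  moreover have "blinfun_apply \<mu> F1 = r - s/2" "blinfun_apply \<mu> F2 = r - s/2" "blinfun_apply \<mu> F3 = r - s/2"
    by (rule val; use F mem in \<open>simp add: ap f_def\<close>)+
  ultimately have "(s/r) * (r - s/2) = 0"
    by (simp add: algebra_simps)
  \<comment> \<open>Both factors are positive, as \<open>0 < s \<le> r\<close>.\<close>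
  then show False
    using s sr by simp
qed

end
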